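(* Let $D$ be a finite set, let $\sigma=(D_1,\ldots,D_T)$ be an ordered collection of nonempty pairwise disjoint groups with $D=\bigcup_{t=1}^T D_t$, and let $v:2^D\to\mathbb{R}$. Let $U_t:=\bigcup_{j=1}^{t}D_j$ for $t=1,\dots,T$ and $U_0:=\varnothing$. Let $\phi^\sigma(z;v,D)$ denote the Asymmetric Data Shapley value. Then for every $t\in\{1,\ldots,T\}$, $$\sum_{z\in D_t}\phi^\sigma(z;v,D)=v(U_t)-v(U_{t-1}).$$
   Context: $\Pi_\sigma(D)$ is the set of permutations (linear orderings) of $D$ in which every element of $D_s$ comes before every element of $D_t$ whenever $s<t$; it has $\prod_{t=1}^T(|D_t|!)$ elements. For a permutation $\pi$ and $z\in D$, $\pi^{<z}$ is the set of elements preceding $z$ in $\pi$. The Asymmetric Data Shapley (ADS) value of $z\in D$ is $$\phi^\sigma(z;v,D)=\frac{1}{\prod_{t=1}^T(|D_t|!)}\sum_{\pi\in\Pi_\sigma(D)}\bigl[v(\pi^{<z}\cup\{z\})-v(\pi^{<z})\bigr].$$ *)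

theory Defs
  imports
    Complex_Main
    "HOL-Library.Disjoint_Sets"
    "HOL-Combinatorics.Multiset_Permutations"
begin

text \<open>
  An ordered collection \<open>(D\<^sub>1, \<dots>, D\<^sub>T)\<close> of groups is a number \<open>T\<close> together with a function
  \<open>G :: nat \<Rightarrow> 'a set\<close>, of which only the values on \<open>{1..T}\<close> matter.
\<close>

definition ordered_groups :: "'a set \<Rightarrow> nat \<Rightarrow> (nat \<Rightarrow> 'a set) \<Rightarrow> bool" where
  "ordered_groups D T G \<longleftrightarrow>
     (\<forall>t\<in>{1..T}. G t \<noteq> {}) \<and> disjoint_family_on G {1..T} \<and> D = (\<Union>t\<in>{1..T}. G t)"

text \<open>
  A linear ordering of \<open>D\<close> is a distinct list with set of elements \<open>D\<close>, first element first.
\<close>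

definition group_perms :: "'a set \<Rightarrow> nat \<Rightarrow> (nat \<Rightarrow> 'a set) \<Rightarrow> 'a list set" where
  "group_perms D T G =
     {p \<in> permutations_of_set D.
        \<forall>s\<in>{1..T}. \<forall>t\<in>{1..T}. s < t \<longrightarrow>
          (\<forall>i<length p. \<forall>j<length p. p ! i \<in> G s \<longrightarrow> p ! j \<in> G t \<longrightarrow> i < j)}"

definition preceding :: "'a list \<Rightarrow> 'a \<Rightarrow> 'a set" where
  "preceding p z = set (takeWhile (\<lambda>x. x \<noteq> z) p)"

text \<open>
  The utility \<open>v\<close> is a total function on sets, but for \<open>z \<in> D\<close> it is only evaluated at subsets
  of \<open>D\<close>.
\<close>

definition ads :: "nat \<Rightarrow> (nat \<Rightarrow> 'a set) \<Rightarrow> 'a \<Rightarrow> ('a set \<Rightarrow> real) \<Rightarrow> 'a set \<Rightarrow> real" where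
  "ads T G z v D =
     1 / (\<Prod>t\<in>{1..T}. fact (card (G t))) *
     (\<Sum>p\<in>group_perms D T G. v (preceding p z \<union> {z}) - v (preceding p z))"

definition union_upto :: "(nat \<Rightarrow> 'a set) \<Rightarrow> nat \<Rightarrow> 'a set" where
  "union_upto G t = (\<Union>j\<in>{1..t}. G j)"

end

theory Submission
  imports Defs
begin

text \<open>
  A group permutation is a concatenation of one linear ordering of each group, in order. Hence
  there are \<open>\<Prod>\<^sub>t |D\<^sub>t|!\<close> of them, and in each of them the elements of \<open>D\<^sub>t\<close> occupy a block that is
  preceded exactly by \<open>U\<^sub>t\<^sub>-\<^sub>1\<close>. The marginal contributions of this block telescope to
  \<open>v(U\<^sub>t) - v(U\<^sub>t\<^sub>-\<^sub>1)\<close>, whatever the permutation, so averaging yields the same value.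
\<close>

lemma preceding_append_Cons:
  "z \<notin> set xs \<Longrightarrow> preceding (xs @ z # ys) z = set xs"
  unfolding preceding_def by (subst takeWhile_append2) auto

text \<open>Telescoping: in a distinct list an element of \<open>ys\<close> is preceded by
  \<open>set xs\<close> together with the earlier elements of \<open>ys\<close>, so consecutive
  marginal contributions cancel.\<close>

lemma sum_marginal_block:
  fixes v :: "'a set \<Rightarrow> real"
  assumes "distinct (xs @ ys @ zs)"
  shows "(\<Sum>z\<in>set ys. v (preceding (xs @ ys @ zs) z \<union> {z}) - v (preceding (xs @ ys @ zs) z))
       = v (set xs \<union> set ys) - v (set xs)"
  using assms
proof (induction ys arbitrary: xs)
  case (Cons y ys)
  have "preceding (xs @ (y # ys) @ zs) y = set xs"
    using Cons.prems preceding_append_Cons[of y xs "ys @ zs"] by simp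
  \<comment> \<open>Moving \<open>y\<close> to the end of the prefix leaves the whole list, and
    hence every other summand, unchanged; the value at \<open>set xs\<close> with \<open>y\<close>
    added cancels.\<close>
  with Cons.prems Cons.IH[of "xs @ [y]"] show ?case
    by (simp add: Un_insert_left insert_commute)
qed simp

text \<open>The order condition is recast as the absence of inversions between pairs of entries, so
  that the rules for \<open>sorted_wrt\<close> on appended lists apply.\<close>

definition group_sorted :: "nat \<Rightarrow> (nat \<Rightarrow> 'a set) \<Rightarrow> 'a list \<Rightarrow> bool" where
  "group_sorted T G =
     sorted_wrt (\<lambda>x y. \<forall>s\<in>{1..T}. \<forall>t\<in>{1..T}. s < t \<longrightarrow> \<not> (x \<in> G t \<and> y \<in> G s))"

text \<open>The two forms differ only at \<open>i = j\<close>: \<open>sorted_wrt\<close> never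
  compares an entry with itself, while the index form demands a strict inequality. Disjointness
  closes this gap, since no entry lies in two groups.\<close>

lemma group_sorted_iff_nth:
  assumes "disjoint_family_on G {1..T}"
  shows "group_sorted T G p \<longleftrightarrow>
    (\<forall>s\<in>{1..T}. \<forall>t\<in>{1..T}. s < t \<longrightarrow>
       (\<forall>i<length p. \<forall>j<length p. p ! i \<in> G s \<longrightarrow> p ! j \<in> G t \<longrightarrow> i < j))"
    (is "_ \<longleftrightarrow> ?R")
proof
  assume sorted: "group_sorted T G p"
  show ?R
  proof (intro ballI allI impI, rule ccontr)
    fix s t i j
    assume st: "s \<in> {1..T}" "t \<in> {1..T}" "s < t"
      and ij: "i < length p" "j < length p" "p ! i \<in> G s" "p ! j \<in> G t" "\<not> i < j"
    have "G s \<inter> G t = {}"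
      using assms st by (auto simp: disjoint_family_on_def)
    then have "j < i"
      using ij by (metis disjoint_iff linorder_neqE_nat)
    then show False
      using sorted st ij unfolding group_sorted_def sorted_wrt_iff_nth_less by blast
  qed
next
  assume ?R
  then show "group_sorted T G p"
    unfolding group_sorted_def sorted_wrt_iff_nth_less
  proof (intro allI impI ballI notI)
    fix i j s t
    assume "i < j" "j < length p" "s \<in> {1..T}" "t \<in> {1..T}" "s < t" "p ! i \<in> G t \<and> p ! j \<in> G s"
    with \<open>?R\<close> have "j < i"
      using less_trans[of i j "length p"] by blast
    with \<open>i < j\<close> show False by simp
  qed
qed

lemma group_perms_eq_group_sorted:
  assumes "disjoint_family_on G {1..T}"
  shows "group_perms D T G = {p \<in> permutations_of_set D. group_sorted T G p}"
  unfolding group_perms_def group_sorted_iff_nth[OF assms] ..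

text \<open>The cut is made at the first entry outside \<open>A\<close>: that entry lies in
  \<open>B\<close>, so no later entry can lie in \<open>A\<close>.\<close>

lemma append_split_if_sorted_wrt:
  assumes "sorted_wrt (\<lambda>x y. \<not> (x \<in> B \<and> y \<in> A)) p" "set p = A \<union> B" "A \<inter> B = {}"
  shows "\<exists>xs ys. p = xs @ ys \<and> set xs = A \<and> set ys = B"
proof -
  \<comment> \<open>Inclusions replace the equalities because they survive the removal of the head
    of the list.\<close>
  have "\<exists>xs ys. p = xs @ ys \<and> set xs \<subseteq> A \<and> set ys \<subseteq> B"
    if "sorted_wrt (\<lambda>x y. \<not> (x \<in> B \<and> y \<in> A)) p" "set p \<subseteq> A \<union> B"
    using that
  proof (induction p)
    case (Cons x p)
    show ?case
    proof (cases "x \<in> A")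
      case True
      from Cons obtain xs ys where "p = xs @ ys" "set xs \<subseteq> A" "set ys \<subseteq> B"
        by auto
      with True show ?thesis
        by (intro exI[of _ "x # xs"] exI[of _ ys]) auto
    next
      case False
      with Cons.prems show ?thesis
        by (intro exI[of _ "[]"] exI[of _ "x # p"]) auto
    qed
  qed simp
  then obtain xs ys where "p = xs @ ys" "set xs \<subseteq> A" "set ys \<subseteq> B"
    using assms by blast
  \<comment> \<open>The inclusions become equalities because \<open>A\<close> and \<open>B\<close>
    are disjoint and \<open>p\<close> exhausts both.\<close>
  moreover from this have "set xs = A" "set ys = B"
    using assms(2,3) by auto
  ultimately show ?thesis by blast
qed

lemma union_upto_0 [simp]: "union_upto G 0 = {}"
  by (simp add: union_upto_def)

lemma union_upto_Suc: "union_upto G (Suc T) = union_upto G T \<union> G (Suc T)"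
  by (auto simp: union_upto_def atLeastAtMostSuc_conv)

lemma union_upto_Int_Suc:
  assumes "disjoint_family_on G {1..Suc T}"
  shows "union_upto G T \<inter> G (Suc T) = {}"
proof -
  have "G t \<inter> G (Suc T) = {}" if "t \<in> {1..T}" for t
    using that by (intro disjoint_family_onD[OF assms]) auto
  then show ?thesis
    unfolding union_upto_def by blast
qed

text \<open>Peels off the last group. This recursion drives both the count of the orderings and the
  location of each block.\<close>

lemma group_perms_Suc:
  assumes disj: "disjoint_family_on G {1..Suc T}"
  shows "group_perms (union_upto G (Suc T)) (Suc T) G =
    (\<lambda>(xs, ys). xs @ ys) ` (group_perms (union_upto G T) T G \<times> permutations_of_set (G (Suc T)))"
proof -
  let ?U = "union_upto G T" and ?V = "G (Suc T)"
  have disj': "disjoint_family_on G {1..T}"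
    using disj by (rule disjoint_family_on_mono[rotated]) auto
  have UV: "?U \<inter> ?V = {}"
    by (rule union_upto_Int_Suc[OF disj])
  \<comment> \<open>Specialising the larger index to \<open>Suc T\<close> shows that nothing in the
    last group precedes an element of an earlier one.\<close>
  have before: "sorted_wrt (\<lambda>x y. \<not> (x \<in> ?V \<and> y \<in> ?U)) p" if "group_sorted (Suc T) G p" for p
    using that unfolding group_sorted_def
  proof (rule sorted_wrt_mono_rel[rotated])
    fix x y
    assume "\<forall>s\<in>{1..Suc T}. \<forall>t\<in>{1..Suc T}. s < t \<longrightarrow> \<not> (x \<in> G t \<and> y \<in> G s)"
    then have "\<forall>s\<in>{1..T}. \<not> (x \<in> ?V \<and> y \<in> G s)"
      by (simp add: atLeastAtMostSuc_conv)
    then show "\<not> (x \<in> ?V \<and> y \<in> ?U)"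
      unfolding union_upto_def by blast
  qed
  \<comment> \<open>Pairs inside \<open>ys\<close> and pairs across the cut are never inverted, so
    only the pairs inside \<open>xs\<close> impose a condition.\<close>
  have append: "group_sorted (Suc T) G (xs @ ys) \<longleftrightarrow> group_sorted T G xs"
    if "set xs = ?U" "set ys = ?V" for xs ys
  proof -
    have only_last: "s = Suc T" if "z \<in> ?V" "s \<in> {1..Suc T}" "z \<in> G s" for z s
    proof (rule ccontr)
      assume "s \<noteq> Suc T"
      then have "G s \<inter> ?V = {}"
        using disjoint_family_onD[OF disj that(2), of "Suc T"] by simp
      with that show False by blast
    qed
    have "group_sorted (Suc T) G ys"
      unfolding group_sorted_def sorted_wrt_iff_nth_less
    proof (intro allI impI ballI notI)
      fix i j s t
      assume *: "i < j" "j < length ys" "s \<in> {1..Suc T}" "t \<in> {1..Suc T}" "s < t"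
        "ys ! i \<in> G t \<and> ys ! j \<in> G s"
      then have "ys ! j \<in> ?V"
        using nth_mem \<open>set ys = ?V\<close> by blast
      then have "s = Suc T"
        using only_last * by blast
      with * show False by simp
    qed
    \<comment> \<open>No entry of \<open>xs\<close> lies in the last group, so letting the indices
      range up to \<open>Suc T\<close> adds no constraint.\<close>
    moreover have "group_sorted (Suc T) G xs \<longleftrightarrow> group_sorted T G xs"
    proof -
      have "(\<forall>s\<in>{1..Suc T}. \<forall>t\<in>{1..Suc T}. s < t \<longrightarrow> \<not> (x \<in> G t \<and> y \<in> G s)) \<longleftrightarrow>
          (\<forall>s\<in>{1..T}. \<forall>t\<in>{1..T}. s < t \<longrightarrow> \<not> (x \<in> G t \<and> y \<in> G s))"
        if "x \<in> set xs" "y \<in> set xs" for x y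
      proof -
        have "x \<notin> ?V" "y \<notin> ?V"
          using that UV \<open>set xs = ?U\<close> by blast+
        then show ?thesis
          by (simp add: atLeastAtMostSuc_conv)
      qed
      then show ?thesis
        unfolding group_sorted_def by (intro iffI; elim sorted_wrt_mono_rel[rotated]) blast+
    qed
    \<comment> \<open>Across the cut, \<open>y\<close> in the last group forces
      \<open>s = Suc T\<close>, which leaves no room for a larger \<open>t\<close>.\<close>
    moreover have "\<not> (x \<in> G t \<and> y \<in> G s)"
      if "x \<in> ?U" "y \<in> ?V" "s \<in> {1..Suc T}" "t \<in> {1..Suc T}" "s < t" for x y s t
      using only_last[OF that(2,3)] that by auto
    ultimately show ?thesis
      unfolding group_sorted_def sorted_wrt_append that by blast
  qed
  show ?thesis
  proof (intro equalityI subsetI)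
    fix p assume "p \<in> group_perms (union_upto G (Suc T)) (Suc T) G"
    then have p: "set p = ?U \<union> ?V" "distinct p" "group_sorted (Suc T) G p"
      by (auto simp: group_perms_eq_group_sorted[OF disj] permutations_of_set_def union_upto_Suc)
    with append_split_if_sorted_wrt[OF before _ UV] obtain xs ys
      where "p = xs @ ys" "set xs = ?U" "set ys = ?V" by blast
    with p append show "p \<in> (\<lambda>(xs, ys). xs @ ys) ` (group_perms ?U T G \<times> permutations_of_set ?V)"
      by (auto simp: group_perms_eq_group_sorted[OF disj'] permutations_of_set_def)
  next
    fix p assume "p \<in> (\<lambda>(xs, ys). xs @ ys) ` (group_perms ?U T G \<times> permutations_of_set ?V)"
    with UV append show "p \<in> group_perms (union_upto G (Suc T)) (Suc T) G"
      by (auto simp: group_perms_eq_group_sorted[OF disj'] group_perms_eq_group_sorted[OF disj]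
          permutations_of_set_def union_upto_Suc)
  qed
qed

lemma card_group_perms:
  assumes "disjoint_family_on G {1..T}" "finite (union_upto G T)"
  shows "card (group_perms (union_upto G T) T G) = (\<Prod>t\<in>{1..T}. fact (card (G t)))"
  using assms
proof (induction T)
  case 0
  then show ?case by (simp add: group_perms_def)
next
  case (Suc T)
  have disj: "disjoint_family_on G {1..T}"
    using Suc.prems(1) by (rule disjoint_family_on_mono[rotated]) auto
  have fin: "finite (union_upto G T)" "finite (G (Suc T))"
    using Suc.prems(2) by (auto simp: union_upto_Suc)
  \<comment> \<open>Concatenation is injective here because all suffixes have the same length, the
    cardinality of the last group.\<close>
  have "inj_on (\<lambda>(xs, ys). xs @ ys)
      (group_perms (union_upto G T) T G \<times> permutations_of_set (G (Suc T)))"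
  proof (rule inj_onI, clarify)
    fix xs ys xs' ys'
    assume "xs @ ys = xs' @ ys'"
      and "ys \<in> permutations_of_set (G (Suc T))" "ys' \<in> permutations_of_set (G (Suc T))"
    moreover from this have "length ys = length ys'"
      by (simp add: length_finite_permutations_of_set)
    ultimately show "xs = xs' \<and> ys = ys'" by simp
  qed
  then show ?case
    using Suc.IH[OF disj fin(1)] fin(2)
    by (simp add: group_perms_Suc[OF Suc.prems(1)] card_image card_cartesian_product)
qed

text \<open>By recursion on the last group: either it is the block sought and \<open>zs\<close> is
  empty, or the block lies in the earlier part and the last group is absorbed into
  \<open>zs\<close>.\<close>

lemma group_perms_split:
  assumes "disjoint_family_on G {1..T}" "p \<in> group_perms (union_upto G T) T G" "t \<in> {1..T}"
  shows "\<exists>xs ys zs. p = xs @ ys @ zs \<and> set xs = union_upto G (t - 1) \<and> set ys = G t"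
  using assms
proof (induction T arbitrary: p)
  case (Suc T)
  from Suc.prems(2) obtain xs ys where p: "p = xs @ ys"
    "xs \<in> group_perms (union_upto G T) T G" "ys \<in> permutations_of_set (G (Suc T))"
    unfolding group_perms_Suc[OF Suc.prems(1)] by auto
  show ?case
  proof (cases "t = Suc T")
    case True
    with p have "p = xs @ ys @ []" "set xs = union_upto G (t - 1)" "set ys = G t"
      by (auto simp: group_perms_def permutations_of_set_def)
    then show ?thesis by blast
  next
    case False
    moreover have "disjoint_family_on G {1..T}"
      using Suc.prems(1) by (rule disjoint_family_on_mono[rotated]) auto
    ultimately obtain as bs cs
      where "xs = as @ bs @ cs" "set as = union_upto G (t - 1)" "set bs = G t"
      using Suc.IH[of xs] p(2) Suc.prems(3) by auto
    with p(1) have "p = as @ bs @ (cs @ ys)" "set as = union_upto G (t - 1)" "set bs = G t"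
      by auto
    then show ?thesis by blast
  qed
qed simp

theorem proposition4p2:
  fixes D :: "'a set" and T :: nat and G :: "nat \<Rightarrow> 'a set" and v :: "'a set \<Rightarrow> real"
  assumes "finite D"
    and "ordered_groups D T G"
  shows "\<forall>t\<in>{1..T}. (\<Sum>z\<in>G t. ads T G z v D) = v (union_upto G t) - v (union_upto G (t - 1))"
proof
  fix t assume t: "t \<in> {1..T}"
  have D: "D = union_upto G T" and disj: "disjoint_family_on G {1..T}"
    using assms(2) by (auto simp: ordered_groups_def union_upto_def)
  let ?P = "group_perms D T G" and ?N = "\<Prod>t\<in>{1..T}. fact (card (G t)) :: real"
  let ?d = "v (union_upto G t) - v (union_upto G (t - 1))"
  \<comment> \<open>The block sum is the same for every ordering, so averaging over the orderings
    will not change it.\<close>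
  have block: "(\<Sum>z\<in>G t. v (preceding p z \<union> {z}) - v (preceding p z)) = ?d" if p: "p \<in> ?P" for p
  proof -
    obtain xs ys zs where split: "p = xs @ ys @ zs" "set xs = union_upto G (t - 1)" "set ys = G t"
      using group_perms_split[OF disj p[unfolded D] t] by blast
    have "distinct p"
      using p by (auto simp: group_perms_def permutations_of_set_def)
    \<comment> \<open>Since \<open>t\<close> is at least 1, the truncated \<open>t - 1\<close> is a
      genuine predecessor.\<close>
    moreover have "union_upto G t = union_upto G (t - 1) \<union> G t"
      using t union_upto_Suc[of G "t - 1"] by simp
    ultimately show ?thesis
      using sum_marginal_block[of xs ys zs v] split by simp
  qed
  \<comment> \<open>The normalising constant in \<open>ads\<close> is the number of orderings, so
    \<open>ads\<close> is a true average.\<close>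
  have card: "real (card ?P) = ?N"
    using card_group_perms[OF disj] assms(1) D by simp
  have "(\<Sum>z\<in>G t. ads T G z v D)
      = 1 / ?N * (\<Sum>p\<in>?P. \<Sum>z\<in>G t. v (preceding p z \<union> {z}) - v (preceding p z))"
    unfolding ads_def sum_distrib_left[symmetric] by (subst sum.swap) simp
  also have "\<dots> = 1 / ?N * (?N * ?d)"
    using block card by simp
  also have "\<dots> = ?d"
    by simp
  finally show "(\<Sum>z\<in>G t. ads T G z v D) = ?d" .
qed

end
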